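(* Every graph $G$ with at least one edge satisfies $\eta(G)\le 2\nu(G)-2$. Moreover, this bound is sharp: there are graphs of arbitrarily large equimatchability defect achieving the bound with equality.
   Context: Graphs are finite, simple and undirected. $\nu(G)$ is the maximum size of a matching of $G$. A matching covers a set $S$ of vertices if every vertex of $S$ is an endpoint of an edge of the matching. A matching is maximal if it is not properly contained in another matching. A set $S\subseteq V(G)$ is equimatchable in $G$ if all maximal matchings of $G$ covering $S$ are of the same size (in particular, a set covered by no matching is vacuously equimatchable). The equimatchability defect $\eta(G)$ is the minimum size of an equimatchable set of $G$. *)

theory Defs
  imports Main
begin

text \<open>A graph is given by its vertex set \<open>V\<close> and its set \<open>E\<close> of edges, an edge being the
  two-element set of its endpoints.\<close>

definition fin_simple_graph :: "'a set \<Rightarrow> 'a set set \<Rightarrow> bool" where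
  "fin_simple_graph V E \<longleftrightarrow> finite V \<and> (\<forall>e\<in>E. e \<subseteq> V \<and> card e = 2)"

definition matching :: "'a set set \<Rightarrow> 'a set set \<Rightarrow> bool" where
  "matching E M \<longleftrightarrow> M \<subseteq> E \<and> (\<forall>e\<in>M. \<forall>f\<in>M. e \<noteq> f \<longrightarrow> e \<inter> f = {})"

definition matching_number :: "'a set set \<Rightarrow> nat" where
  "matching_number E = Max {card M | M. matching E M}"

definition maximal_matching :: "'a set set \<Rightarrow> 'a set set \<Rightarrow> bool" where
  "maximal_matching E M \<longleftrightarrow> matching E M \<and> \<not> (\<exists>N. matching E N \<and> M \<subset> N)"

definition covers :: "'a set set \<Rightarrow> 'a set \<Rightarrow> bool" where
  "covers M S \<longleftrightarrow> (\<forall>v\<in>S. \<exists>e\<in>M. v \<in> e)"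

definition equimatchable_set :: "'a set \<Rightarrow> 'a set set \<Rightarrow> 'a set \<Rightarrow> bool" where
  "equimatchable_set V E S \<longleftrightarrow> S \<subseteq> V \<and>
     (\<forall>M N. maximal_matching E M \<and> covers M S \<and> maximal_matching E N \<and> covers N S
        \<longrightarrow> card M = card N)"

text \<open>The minimum exists for every finite simple graph: the set of vertices covered by a maximum
  matching is equimatchable.\<close>

definition equimatchability_defect :: "'a set \<Rightarrow> 'a set set \<Rightarrow> nat" where
  "equimatchability_defect V E = (LEAST k. \<exists>S. equimatchable_set V E S \<and> card S = k)"

end

theory Submission
  imports Defs
begin

text \<open>
  \<^bold>\<open>Upper bound.\<close> Let \<open>M\<close> be a maximum matching and \<open>e\<close> one of its edges. The set \<open>S\<close> of the
  \<open>2\<nu> - 2\<close> vertices covered by \<open>M - {e}\<close> is equimatchable: a matching covering \<open>S\<close> has at least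
  \<open>\<nu> - 1\<close> edges, and if it has exactly that many, then it covers nothing outside \<open>S\<close>, so that \<open>e\<close> can
  be added to it. Hence every maximal matching covering \<open>S\<close> has size \<open>\<nu>\<close>.

  \<^bold>\<open>Sharpness.\<close> Suppose that a graph has a perfect matching, and that any three of its vertices include
  two nonadjacent ones \<open>a\<close>, \<open>b\<close> whose deletion leaves a graph with a perfect matching. A set
  \<open>S\<close> that misses at least three vertices misses such a pair \<open>a\<close>, \<open>b\<close>. Since \<open>a\<close> and \<open>b\<close> are
  nonadjacent, a perfect matching of the graph without \<open>a\<close> and \<open>b\<close> is a maximal matching of the whole
  graph; it covers \<open>S\<close> and has one edge less than a perfect matching, which covers \<open>S\<close> as well. So
  only sets of at least \<open>|V| - 2 = 2\<nu> - 2\<close> vertices are equimatchable.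

  On six or more vertices, the condition on triples forces the graph to be triangle-free and
  non-bipartite, which suggests starting from a five-cycle. Its blow-up satisfies the condition if
  each vertex of the cycle is replaced by \<open>2h > 0\<close> independent vertices. A perfect matching takes
  \<open>h\<close> edges between any two consecutive classes. Changing these numbers by at most one each makes up
  for the deletion of two vertices from the same class or from two nonconsecutive classes, and
  any three vertices include two of this kind, because the five-cycle has no triangle.
\<close>

section \<open>Matchings and their sizes\<close>

lemma card_Union_matching:
  assumes "fin_simple_graph V E" "matching E M"
  shows "card (\<Union>M) = 2 * card M"
proof -
  have two: "card e = 2" "finite e" if "e \<in> M" for e
    using assms that by (auto simp: fin_simple_graph_def matching_def card_2_iff)
  have "card (\<Union>M) = sum card M"
    using assms two(2) by (intro card_Union_disjoint) (auto simp: matching_def pairwise_def disjnt_def)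
  also have "\<dots> = 2 * card M"
    using two(1) by simp
  finally show ?thesis .
qed

lemma finite_Union_matching:
  assumes "fin_simple_graph V E" "matching E M"
  shows "\<Union>M \<subseteq> V" "finite (\<Union>M)" "finite M"
proof -
  show sub: "\<Union>M \<subseteq> V"
    using assms unfolding fin_simple_graph_def matching_def by blast
  show fin: "finite (\<Union>M)"
    using assms(1) sub by (auto simp: fin_simple_graph_def intro: finite_subset)
  then show "finite M"
    by (rule finite_UnionD)
qed

lemma finite_matching_sizes:
  assumes "fin_simple_graph V E"
  shows "finite {card M | M. matching E M}"
proof -
  have "finite E"
    using assms by (auto simp: fin_simple_graph_def intro: finite_subset[of E "Pow V"])
  then have "finite {M. matching E M}"
    by (auto simp: matching_def intro: finite_subset[of _ "Pow E"])
  then show ?thesis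
    by (simp add: setcompr_eq_image)
qed

lemma card_le_matching_number:
  assumes "fin_simple_graph V E" "matching E M"
  shows "card M \<le> matching_number E"
  unfolding matching_number_def using assms finite_matching_sizes by (intro Max_ge) auto

lemma maximum_matching_exists:
  assumes "fin_simple_graph V E"
  obtains M where "matching E M" "card M = matching_number E"
proof -
  have "matching E {}"
    by (simp add: matching_def)
  then have "Max {card M | M. matching E M} \<in> {card M | M. matching E M}"
    using finite_matching_sizes[OF assms] by (intro Max_in) auto
  then show thesis
    using that unfolding matching_number_def by auto
qed

lemma matching_insert:
  assumes "matching E M" "e \<in> E" "e \<inter> \<Union>M = {}"
  shows "matching E (insert e M)"
proof -
  have disj: "e \<inter> f = {}" "f \<inter> e = {}" if "f \<in> M" for f
    using assms(3) that by blast+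
  then show ?thesis
    using assms(1,2) by (simp add: matching_def)
qed

text \<open>The edges that can be added to a matching are those disjoint from all edges of it.\<close>

lemma maximal_matching_iff:
  assumes "fin_simple_graph V E"
  shows "maximal_matching E M \<longleftrightarrow> matching E M \<and> (\<forall>e\<in>E. e \<inter> \<Union>M \<noteq> {})"
proof (intro iffI conjI ballI)
  assume max: "maximal_matching E M"
  then show M: "matching E M"
    by (simp add: maximal_matching_def)
  fix e assume e: "e \<in> E"
  show "e \<inter> \<Union>M \<noteq> {}"
  proof
    assume disj: "e \<inter> \<Union>M = {}"
    have "e \<noteq> {}"
      using assms e by (auto simp: fin_simple_graph_def)
    then have "e \<notin> M"
      using disj by auto
    then show False
      using max matching_insert[OF M e disj] unfolding maximal_matching_def by blast
  qed
next
  assume M: "matching E M \<and> (\<forall>e\<in>E. e \<inter> \<Union>M \<noteq> {})"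
  show "maximal_matching E M"
    unfolding maximal_matching_def
  proof (intro conjI notI)
    assume "\<exists>N. matching E N \<and> M \<subset> N"
    then obtain N e where N: "matching E N" "M \<subseteq> N" "e \<in> N" "e \<notin> M"
      by blast
    have "e \<inter> f = {}" if "f \<in> M" for f
    proof -
      have "f \<in> N" "e \<noteq> f"
        using N that by auto
      then show ?thesis
        using N(1,3) by (simp add: matching_def)
    qed
    then have "e \<inter> \<Union>M = {}"
      by blast
    moreover have "e \<in> E"
      using N by (auto simp: matching_def)
    ultimately show False
      using M by blast
  qed (use M in simp)
qed

section \<open>The upper bound\<close>

text \<open>Witnessed by the vertices of a maximum matching minus one of its edges.\<close>

lemma equimatchable_set_exists:
  assumes G: "fin_simple_graph V E" and "E \<noteq> {}"
  shows "matching_number E \<ge> 1"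
    and "\<exists>S. equimatchable_set V E S \<and> card S = 2 * matching_number E - 2"
proof -
  obtain e0 where "e0 \<in> E"
    using \<open>E \<noteq> {}\<close> by auto
  then have "matching E {e0}"
    by (simp add: matching_def)
  from card_le_matching_number[OF G this] show pos: "matching_number E \<ge> 1"
    by simp
  obtain M where M: "matching E M" "card M = matching_number E"
    using maximum_matching_exists[OF G] .
  then obtain e where e: "e \<in> M"
    using pos by fastforce
  define S where "S = \<Union>(M - {e})"
  have M': "matching E (M - {e})"
    using M(1) by (auto simp: matching_def)
  have card_S: "card S = 2 * matching_number E - 2"
    using card_Union_matching[OF G M'] finite_Union_matching(3)[OF G M(1)] e M(2)
    by (simp add: S_def algebra_simps)
  have disj: "e \<inter> S = {}"
    using M(1) e unfolding S_def matching_def by blast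
  have size: "card N = matching_number E" if N: "maximal_matching E N" "covers N S" for N
  proof (rule antisym)
    have matN: "matching E N"
      using N(1) by (simp add: maximal_matching_def)
    then show "card N \<le> matching_number E"
      by (rule card_le_matching_number[OF G])
    have "e \<inter> \<Union>N \<noteq> {}"
      using N(1) e M(1) unfolding maximal_matching_iff[OF G] by (auto simp: matching_def)
    \<comment> \<open>so \<open>N\<close> covers a vertex of \<open>e\<close> besides all of \<open>S\<close>\<close>
    then have "S \<subset> \<Union>N"
      using N(2) disj unfolding covers_def by blast
    then have "card S < card (\<Union>N)"
      using finite_Union_matching(2)[OF G matN] by (rule psubset_card_mono[rotated])
    then show "matching_number E \<le> card N"
      using card_Union_matching[OF G matN] card_S by linarith
  qed
  have "S \<subseteq> V"
    using finite_Union_matching(1)[OF G M'] by (simp add: S_def)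
  then have "equimatchable_set V E S"
    using size by (auto simp: equimatchable_set_def)
  then show "\<exists>S. equimatchable_set V E S \<and> card S = 2 * matching_number E - 2"
    using card_S by blast
qed

lemma equimatchability_defect_le:
  assumes "fin_simple_graph V E" "E \<noteq> {}"
  shows "equimatchability_defect V E \<le> 2 * matching_number E - 2"
  unfolding equimatchability_defect_def using equimatchable_set_exists(2)[OF assms] by (rule Least_le)

section \<open>A criterion for equality\<close>

lemma matching_number_perfect:
  assumes G: "fin_simple_graph V E" and P: "matching E P" "\<Union>P = V"
  shows "2 * matching_number E = card V"
proof -
  obtain M where M: "matching E M" "card M = matching_number E"
    using maximum_matching_exists[OF G] .
  have "card (\<Union>M) \<le> card V"
    using G finite_Union_matching(1)[OF G M(1)] by (simp add: fin_simple_graph_def card_mono)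
  then show ?thesis
    using card_Union_matching[OF G M(1)] card_Union_matching[OF G P(1)] M(2) P(2)
      card_le_matching_number[OF G P(1)] by simp
qed

text \<open>A set that misses three vertices is covered both by a perfect matching and by the
  smaller maximal matching that leaves out two nonadjacent vertices among them.\<close>

lemma equimatchability_defect_eq:
  assumes G: "fin_simple_graph V E" and P: "matching E P" "\<Union>P = V" and "E \<noteq> {}"
    and triples: "\<And>T. T \<subseteq> V \<Longrightarrow> card T = 3 \<Longrightarrow>
      \<exists>a\<in>T. \<exists>b\<in>T. a \<noteq> b \<and> {a, b} \<notin> E \<and> (\<exists>N. matching E N \<and> \<Union>N = V - {a, b})"
  shows "equimatchability_defect V E = card V - 2"
proof (rule antisym)
  show "equimatchability_defect V E \<le> card V - 2"
    using equimatchability_defect_le[OF G \<open>E \<noteq> {}\<close>] matching_number_perfect[OF G P] by simp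
  have two: "card e = 2" "e \<subseteq> V" if "e \<in> E" for e
    using G that by (auto simp: fin_simple_graph_def)
  have finV: "finite V"
    using G by (simp add: fin_simple_graph_def)
  have large: "card V - 2 \<le> card S" if S: "equimatchable_set V E S" for S
  proof (rule ccontr)
    have SV: "S \<subseteq> V"
      using S by (simp add: equimatchable_set_def)
    assume "\<not> card V - 2 \<le> card S"
    then have "3 \<le> card (V - S)"
      using SV finV by (simp add: card_Diff_subset finite_subset)
    then obtain T where T: "T \<subseteq> V - S" "card T = 3"
      by (meson obtain_subset_with_card_n)
    then have "T \<subseteq> V"
      by blast
    from triples[OF this T(2)] obtain a b N where ab: "a \<in> V - S" "b \<in> V - S" "a \<noteq> b" "{a, b} \<notin> E"
      and N: "matching E N" "\<Union>N = V - {a, b}"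
      using T(1) by (elim bexE conjE exE) auto
    have "e \<inter> \<Union>N \<noteq> {}" if e: "e \<in> E" for e
    proof
      assume "e \<inter> \<Union>N = {}"
      then have "e \<subseteq> {a, b}"
        using two(2)[OF e] N(2) by blast
      then have "e = {a, b}"
        using two(1)[OF e] ab(3) by (intro card_subset_eq) auto
      then show False
        using e ab(4) by simp
    qed
    then have maxN: "maximal_matching E N"
      using N(1) unfolding maximal_matching_iff[OF G] by simp
    have "e \<inter> \<Union>P \<noteq> {}" if e: "e \<in> E" for e
      using two[OF e] P(2) by (auto simp: Int_absorb2)
    then have maxP: "maximal_matching E P"
      using P(1) unfolding maximal_matching_iff[OF G] by simp
    have "covers N S"
      using N(2) ab SV unfolding covers_def by blast
    moreover have "covers P S"
      using P(2) SV unfolding covers_def by blast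
    ultimately have "card N = card P"
      using S maxN maxP unfolding equimatchable_set_def by blast
    then have "card (V - {a, b}) = card V"
      using card_Union_matching[OF G N(1)] card_Union_matching[OF G P(1)] N(2) P(2) by simp
    moreover have "card (V - {a, b}) < card V"
      using ab(1) finV by (intro psubset_card_mono) auto
    ultimately show False
      by simp
  qed
  have "\<exists>k S. equimatchable_set V E S \<and> card S = k"
    using equimatchable_set_exists(2)[OF G \<open>E \<noteq> {}\<close>] by blast
  then have "\<exists>S. equimatchable_set V E S \<and> card S = equimatchability_defect V E"
    unfolding equimatchability_defect_def by (rule LeastI_ex)
  then show "card V - 2 \<le> equimatchability_defect V E"
    using large by metis
qed

section \<open>Blow-ups of the five-cycle\<close>

text \<open>The function \<open>c\<close> sends each vertex to a vertex \<open>0, \<dots>, 4\<close> of the five-cycle, its colour.\<close>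

definition blowup_edges :: "'a set \<Rightarrow> ('a \<Rightarrow> nat) \<Rightarrow> 'a set set" where
  "blowup_edges W c = {{u, v} | u v. u \<in> W \<and> v \<in> W \<and> c v = Suc (c u) mod 5}"

lemma blowup_edges_mono: "W \<subseteq> W' \<Longrightarrow> blowup_edges W c \<subseteq> blowup_edges W' c"
  unfolding blowup_edges_def by blast

lemma matching_mono: "matching E M \<Longrightarrow> E \<subseteq> F \<Longrightarrow> matching F M"
  unfolding matching_def by blast

lemma Suc_mod_5_neq: "Suc n mod 5 \<noteq> n"
proof (cases "Suc n < 5")
  case False
  moreover have "Suc n mod 5 < 5"
    by simp
  ultimately show ?thesis
    by (cases "n = 4") auto
qed simp

lemma fin_simple_graph_blowup:
  assumes "finite W"
  shows "fin_simple_graph W (blowup_edges W c)"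
proof -
  have "card {u, v} = 2" if "c v = Suc (c u) mod 5" for u v
  proof -
    have "c v \<noteq> c u"
      unfolding that by (rule Suc_mod_5_neq)
    then show ?thesis
      by (auto simp: card_2_iff)
  qed
  then show ?thesis
    using assms unfolding fin_simple_graph_def blowup_edges_def by auto
qed

lemma card_colour_class_delete:
  assumes "finite W" "u \<in> W" "v \<in> W" "u \<noteq> v"
  shows "card {w \<in> W. c w = j} = card {w \<in> W - {u, v}. c w = j}
    + (if c u = j then 1 else 0) + (if c v = j then 1 else 0)"
proof -
  have "{w \<in> W. c w = j} = {w \<in> W - {u, v}. c w = j} \<union> {w \<in> {u, v}. c w = j}"
    using assms by auto
  then have "card {w \<in> W. c w = j} = card {w \<in> W - {u, v}. c w = j} + card {w \<in> {u, v}. c w = j}"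
    using assms(1) by (simp only:) (subst card_Un_disjoint, auto)
  moreover have "{w \<in> {u, v}. c w = j} = (if c u = j then {u} else {}) \<union> (if c v = j then {v} else {})"
    by auto
  ultimately show ?thesis
    using assms(4) by (simp split: if_splits)
qed

lemma less_5_cases: "(j::nat) < 5 \<Longrightarrow> j = 0 \<or> j = 1 \<or> j = 2 \<or> j = 3 \<or> j = 4"
  by arith

lemma pred_mod_5_eq_iff:
  assumes "(i::nat) < 5" "j < 5"
  shows "(j + 4) mod 5 = i \<longleftrightarrow> j = Suc i mod 5"
  using assms[THEN less_5_cases] by (elim disjE; simp)

text \<open>Vertices of the same class are interchangeable, so a perfect matching exists as soon as the class
  sizes allow it: \<open>x i\<close> edges between the classes \<open>i\<close> and \<open>i + 1\<close> use up the class \<open>j\<close> if its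
  size is \<open>x j + x (j - 1)\<close>. The matching is chosen greedily, one edge at a time.\<close>

lemma blowup_perfect_matching:
  assumes "finite W" "\<forall>w\<in>W. c w < 5"
    and "\<forall>j<5. card {w \<in> W. c w = j} = x j + x ((j + 4) mod 5)"
  shows "\<exists>M. matching (blowup_edges W c) M \<and> \<Union>M = W"
  using assms
proof (induction "\<Sum>i<5. x i" arbitrary: W x)
  case 0
  then have "x i = 0" if "i < 5" for i
    using that by simp
  then have "\<forall>j<5. {w \<in> W. c w = j} = {}"
    using 0 by simp
  then have "W = {}"
    using 0(3) by blast
  then show ?case
    by (auto simp: matching_def)
next
  case (Suc n)
  have "\<exists>i<5. x i > 0"
  proof (rule ccontr)
    assume "\<not> (\<exists>i<5. x i > 0)"
    then have "(\<Sum>i<5. x i) = 0" by simp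
    then show False using Suc(2) by simp
  qed
  then obtain i where i: "i < 5" "x i > 0"
    by blast
  have pred: "(j + 4) mod 5 = i \<longleftrightarrow> j = Suc i mod 5" if "j < 5" for j
    using pred_mod_5_eq_iff[OF i(1) that] .
  have "card {w \<in> W. c w = i} > 0"
    using Suc.prems(3) i by simp
  then obtain u where u: "u \<in> W" "c u = i"
    by (auto simp: card_gt_0_iff)
  have "card {w \<in> W. c w = Suc i mod 5} > 0"
    using Suc.prems(3)[rule_format, of "Suc i mod 5"] pred[of "Suc i mod 5"] i(2) by simp
  then obtain v where v: "v \<in> W" "c v = Suc i mod 5"
    by (auto simp: card_gt_0_iff)
  note ne = Suc_mod_5_neq[of i]
  then have uv: "u \<noteq> v"
    using u v by auto
  define y where "y = x(i := x i - 1)"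
  have "(\<Sum>j<5. x j) = Suc (\<Sum>j<5. y j)"
    using i sum.remove[of "{..<5}" i x] sum.remove[of "{..<5}" i y]
    by (simp add: y_def)
  then have n: "n = (\<Sum>j<5. y j)"
    using Suc(2) by simp
  have classes: "\<forall>j<5. card {w \<in> W - {u, v}. c w = j} = y j + y ((j + 4) mod 5)"
  proof (intro allI impI)
    fix j :: nat assume j: "j < 5"
    have "card {w \<in> W - {u, v}. c w = j} + (if i = j then 1 else 0)
        + (if Suc i mod 5 = j then 1 else 0) = x j + x ((j + 4) mod 5)"
      using card_colour_class_delete[OF Suc.prems(1) u(1) v(1) uv, of c j] Suc.prems(3) j u(2) v(2)
      by simp
    then show "card {w \<in> W - {u, v}. c w = j} = y j + y ((j + 4) mod 5)"
      using pred[OF j] ne i(2) by (auto simp: y_def split: if_splits)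
  qed
  obtain M where M: "matching (blowup_edges (W - {u, v}) c) M" "\<Union>M = W - {u, v}"
    using Suc(1)[OF n _ _ classes] Suc.prems by auto
  have "matching (blowup_edges W c) M"
    using M(1) by (rule matching_mono) (intro blowup_edges_mono Diff_subset)
  moreover have "{u, v} \<in> blowup_edges W c"
    using u v unfolding blowup_edges_def by blast
  ultimately have "matching (blowup_edges W c) (insert {u, v} M)"
    using M(2) by (intro matching_insert) auto
  moreover have "\<Union>(insert {u, v} M) = W"
    using M(2) u v by auto
  ultimately show ?case
    by blast
qed

lemma not_consecutive:
  assumes "(x::nat) < 5" "y = x \<or> y = (x + 2) mod 5"
  shows "y \<noteq> Suc x mod 5" "x \<noteq> Suc y mod 5"
  using less_5_cases[OF assms(1)] assms(2) by (elim disjE; simp)+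

lemma five_cycle_triangle_free:
  assumes "(x::nat) < 5" "y < 5" "z < 5"
  shows "(x = y \<or> x = (y + 2) mod 5 \<or> y = (x + 2) mod 5)
    \<or> (y = z \<or> y = (z + 2) mod 5 \<or> z = (y + 2) mod 5)
    \<or> (x = z \<or> x = (z + 2) mod 5 \<or> z = (x + 2) mod 5)"
  using assms[THEN less_5_cases] by (elim disjE; simp)

text \<open>If \<open>a\<close> and \<open>b\<close> have the same colour \<open>i\<close>, then the numbers of edges between consecutive classes,
  starting with the classes \<open>i\<close> and \<open>i + 1\<close>, change from \<open>h\<close> to \<open>h - 1, h + 1, h - 1, h + 1, h - 1\<close>.
  If they have the colours \<open>i\<close> and \<open>i + 2\<close>, then only the edges on the path through the
  classes \<open>i + 2, i + 3, i + 4, i\<close> change in number, to \<open>h - 1, h + 1, h - 1\<close>.\<close>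

lemma blowup_delete_pair:
  assumes W: "finite W" "\<forall>w\<in>W. c w < 5"
    and sizes: "\<forall>j<5. card {w \<in> W. c w = j} = 2 * h" and "h > 0"
    and ab: "a \<in> W" "b \<in> W" "a \<noteq> b" and col: "c b = c a \<or> c b = (c a + 2) mod 5"
  shows "\<exists>N. matching (blowup_edges W c) N \<and> \<Union>N = W - {a, b}"
proof -
  define i where "i = c a"
  have i: "i < 5"
    using W(2) ab(1) by (simp add: i_def)
  define x where "x j = (if c b = i
     then (if j = (i + 1) mod 5 \<or> j = (i + 3) mod 5 then h + 1 else h - 1)
     else (if j = (i + 3) mod 5 then h + 1
           else if j = (i + 2) mod 5 \<or> j = (i + 4) mod 5 then h - 1 else h))" for j
  have "card {w \<in> W - {a, b}. c w = j} = x j + x ((j + 4) mod 5)" if j: "j < 5" for j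
  proof -
    have "card {w \<in> W - {a, b}. c w = j} + (if i = j then 1 else 0)
        + (if c b = j then 1 else 0) = 2 * h"
      using card_colour_class_delete[OF W(1) ab, of c j] sizes j by (simp add: i_def)
    then show ?thesis
      using less_5_cases[OF i] less_5_cases[OF j] col[folded i_def] \<open>h > 0\<close> unfolding x_def
      by - (elim disjE; simp)
  qed
  then obtain N where "matching (blowup_edges (W - {a, b}) c) N" "\<Union>N = W - {a, b}"
    using blowup_perfect_matching[of "W - {a, b}" c x] W by auto
  then show ?thesis
    using matching_mono blowup_edges_mono[of "W - {a, b}" W c] by blast
qed

lemma blowup_defect:
  assumes W: "finite W" "\<forall>w\<in>W. c w < 5"
    and sizes: "\<forall>j<5. card {w \<in> W. c w = j} = 2 * h" and "h > 0"
  shows "blowup_edges W c \<noteq> {}"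
    and "2 * matching_number (blowup_edges W c) = card W"
    and "equimatchability_defect W (blowup_edges W c) = card W - 2"
proof -
  obtain P where P: "matching (blowup_edges W c) P" "\<Union>P = W"
    using blowup_perfect_matching[OF W, of "\<lambda>_. h"] sizes by auto
  note G = fin_simple_graph_blowup[OF W(1), of c]
  have "W \<noteq> {}"
    using sizes[rule_format, of 0] \<open>h > 0\<close> by auto
  then show ne: "blowup_edges W c \<noteq> {}"
    using P by (auto simp: matching_def)
  show "2 * matching_number (blowup_edges W c) = card W"
    by (rule matching_number_perfect[OF G P])
  show "equimatchability_defect W (blowup_edges W c) = card W - 2"
  proof (rule equimatchability_defect_eq[OF G P ne])
    fix T assume T: "T \<subseteq> W" "card T = 3"
    then obtain p q r where pqr: "T = {p, q, r}" "p \<noteq> q" "p \<noteq> r" "q \<noteq> r"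
      by (auto simp: card_3_iff)
    have "c p < 5" "c q < 5" "c r < 5"
      using pqr T W(2) by auto
    then have "\<exists>(a, b)\<in>{(p, q), (q, p), (q, r), (r, q), (p, r), (r, p)}.
        c b = c a \<or> c b = (c a + 2) mod 5"
      using five_cycle_triangle_free[of "c p" "c q" "c r"] by auto
    then have "\<exists>a\<in>T. \<exists>b\<in>T. a \<noteq> b \<and> (c b = c a \<or> c b = (c a + 2) mod 5)"
      using pqr by auto
    then obtain a b where ab: "a \<in> T" "b \<in> T" "a \<noteq> b" "c b = c a \<or> c b = (c a + 2) mod 5"
      by blast
    have "c a < 5"
      using ab(1) T(1) W(2) by auto
    then have "\<not> c b = Suc (c a) mod 5" "\<not> c a = Suc (c b) mod 5"
      using not_consecutive[OF _ ab(4)] by blast+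
    then have "{a, b} \<notin> blowup_edges W c"
      by (auto simp: blowup_edges_def doubleton_eq_iff)
    moreover have "\<exists>N. matching (blowup_edges W c) N \<and> \<Union>N = W - {a, b}"
      using ab(1,2) T(1) by (intro blowup_delete_pair[OF W sizes \<open>h > 0\<close> _ _ ab(3,4)]) auto
    ultimately show "\<exists>a\<in>T. \<exists>b\<in>T. a \<noteq> b \<and> {a, b} \<notin> blowup_edges W c
        \<and> (\<exists>N. matching (blowup_edges W c) N \<and> \<Union>N = W - {a, b})"
      using ab(3) by (intro bexI[OF _ ab(1)] bexI[OF _ ab(2)] conjI)
  qed
qed

lemma card_residue_class:
  assumes "j < (m::nat)"
  shows "card {v \<in> {..<m * n}. v mod m = j} = n"
proof -
  have "{v \<in> {..<m * n}. v mod m = j} = (\<lambda>q. m * q + j) ` {..<n}"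
  proof (intro set_eqI iffI)
    fix v assume v: "v \<in> {v \<in> {..<m * n}. v mod m = j}"
    then have "v div m < n"
      by (simp add: less_mult_imp_div_less mult.commute)
    moreover have "v = m * (v div m) + j"
      using v by (metis (mono_tags, lifting) mem_Collect_eq mult_div_mod_eq)
    ultimately show "v \<in> (\<lambda>q. m * q + j) ` {..<n}"
      by blast
  next
    fix v assume "v \<in> (\<lambda>q. m * q + j) ` {..<n}"
    then obtain q where q: "q < n" "v = m * q + j"
      by auto
    have "m * q + j < m * Suc q"
      using assms by simp
    also have "\<dots> \<le> m * n"
      using q(1) by (intro mult_le_mono2) simp
    finally show "v \<in> {v \<in> {..<m * n}. v mod m = j}"
      using q assms by simp
  qed
  moreover have "inj_on (\<lambda>q. m * q + j) {..<n}"
    using assms by (auto simp: inj_on_def)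
  ultimately show ?thesis
    by (simp add: card_image)
qed

theorem theorem3p11:
  "(\<forall>(V :: 'a set) E. fin_simple_graph V E \<and> E \<noteq> {} \<longrightarrow>
      int (equimatchability_defect V E) \<le> 2 * int (matching_number E) - 2)
   \<and> (\<forall>k. \<exists>(V :: nat set) E. fin_simple_graph V E \<and> E \<noteq> {} \<and>
      equimatchability_defect V E \<ge> k \<and>
      int (equimatchability_defect V E) = 2 * int (matching_number E) - 2)"
proof (intro conjI allI impI)
  fix V :: "'a set" and E
  assume "fin_simple_graph V E \<and> E \<noteq> {}"
  then show "int (equimatchability_defect V E) \<le> 2 * int (matching_number E) - 2"
    using equimatchability_defect_le[of V E] equimatchable_set_exists(1)[of V E] by linarith
next
  fix k :: nat
  define W :: "nat set" where "W = {..<5 * (2 * Suc k)}"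
  define E where "E = blowup_edges W (\<lambda>v. v mod 5)"
  have W: "finite W" "\<forall>w\<in>W. w mod 5 < 5"
    by (simp_all add: W_def)
  have sizes: "\<forall>j<5. card {w \<in> W. w mod 5 = j} = 2 * Suc k"
    unfolding W_def using card_residue_class by blast
  have "card W = 10 * Suc k"
    by (simp add: W_def)
  then show "\<exists>(V :: nat set) E. fin_simple_graph V E \<and> E \<noteq> {} \<and>
      equimatchability_defect V E \<ge> k \<and>
      int (equimatchability_defect V E) = 2 * int (matching_number E) - 2"
    using fin_simple_graph_blowup[OF W(1), of "\<lambda>v. v mod 5"] blowup_defect[OF W sizes]
    by (intro exI[of _ W] exI[of _ E]) (simp add: E_def)
qed

end
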